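(* Let $\mathcal{S}$ be a finite species with a distinguished color $S$, and let $\mathrm{Univ}_{\mathcal{S},S}=(\mathcal{C}[\mathcal{S}],\mathcal{S},S,p_{\mathcal{S}})$ be its universal context-free grammar. For every context-free grammar of arrows $G=(\mathcal{C},\mathcal{S},S,p)$ with the same species and start symbol, there exists a unique functor of categories $q_G:\mathcal{C}[\mathcal{S}]\to\mathcal{C}$ such that $p=\mathcal{W}[q_G]\circ p_{\mathcal{S}}$ as functors of operads $\mathsf{Free}\,\mathcal{S}\to\mathcal{W}[\mathcal{C}]$. Moreover $L_G=q_G(L_{\mathcal{S},S})$, where $L_{\mathcal{S},S}$ is the language generated by $\mathrm{Univ}_{\mathcal{S},S}$.
   Context: "Operad" means colored non-symmetric operad (multicategory); a functor of operads maps colors and operations preserving types, identities and composition. A constant is an operation of arity $0$; $\alpha:S$ means $\alpha$ is a constant with output color $S$. Composition of arrows in categories is written in diagrammatic order. A species $\mathcal{S}$ consists of a set $C$ of colors, a set $V$ of nodes, and functions $i:V\to C^*$ (input colors), $o:V\to C$ (output color); write $x:R_1,\dots,R_n\to R$ for a node. It is finite if $C$ and $V$ are finite. $\mathsf{Free}\,\mathcal{S}$ is the free operad on $\mathcal{S}$. The operad $\mathcal{W}[\mathcal{C}]$ of spliced arrows of a category $\mathcal{C}$ has as colors the pairs $(A,B)$ of objects; an $n$-ary operation $(A_1,B_1),\dots,(A_n,B_n)\to(A,B)$ is a sequence $w_0{-}\cdots{-}w_n$ of arrows $w_i:B_i\to A_{i+1}$ ($0\le i\le n$, with $B_0=A$,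 $A_{n+1}=B$). Composition substitutes spliced arrows for the gaps "$-$", interpreting juxtaposition as composition in $\mathcal{C}$; the identity on $(A,B)$ is $\mathrm{id}_A{-}\mathrm{id}_B$. For a functor $F$, $\mathcal{W}[F]$ applies $F$ componentwise. A context-free grammar of arrows $G=(\mathcal{C},\mathcal{S},S,p)$ consists of a finitely generated category $\mathcal{C}$, a finite species $\mathcal{S}$, a color $S$ of $\mathcal{S}$, and a functor of operads $p:\mathsf{Free}\,\mathcal{S}\to\mathcal{W}[\mathcal{C}]$. Its language is $L_G=\{p(\alpha)\mid\alpha:S\}$, a set of arrows of $\mathcal{C}$ (constants of $\mathcal{W}[\mathcal{C}]$ are arrows of $\mathcal{C}$). $\mathcal{C}[\mathcal{S}]$ (the contour category of $\mathsf{Free}\,\mathcal{S}$) is the free category whose objects are $R^u,R^d$ for each color $R$ of $\mathcal{S}$, with a generating arrow $(x,i):R_i^d\to R_{i+1}^u$ for each node $x:R_1,\dots,R_n\to R$ and $0\le i\le n$, under the conventions $R_0^d=R^u$, $R_{n+1}^u=R^d$. The functor $p_{\mathcal{S}}:\mathsf{Free}\,\mathcal{S}\to\mathcal{W}[\mathcal{C}[\mathcal{S}]]$ is determined by $R\mapsto(R^u,R^d)$ and $x\mapsto(x,0){-}\cdots{-}(x,n)$ for every $n$-ary node $x$. *)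

theory Defs
  imports Main "HOL-Library.FuncSet"
begin

section \<open>Categories and functors\<close>

text \<open>
  Composition is written in diagrammatic order: \<^term>\<open>Comp C f g\<close> is first \<open>f\<close>, then \<open>g\<close>.
  It is only meaningful on composable arrows of the carrier.
\<close>

record ('o, 'a) category =
  Obj :: "'o set"
  Arr :: "'a set"
  Dom :: "'a \<Rightarrow> 'o"
  Cod :: "'a \<Rightarrow> 'o"
  Ident :: "'o \<Rightarrow> 'a"
  Comp :: "'a \<Rightarrow> 'a \<Rightarrow> 'a"

locale category =
  fixes C :: "('o, 'a) category"
  assumes Dom_in: "f \<in> Arr C \<Longrightarrow> Dom C f \<in> Obj C"
    and Cod_in: "f \<in> Arr C \<Longrightarrow> Cod C f \<in> Obj C"
    and Ident_in: "A \<in> Obj C \<Longrightarrow> Ident C A \<in> Arr C"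
    and Dom_Ident: "A \<in> Obj C \<Longrightarrow> Dom C (Ident C A) = A"
    and Cod_Ident: "A \<in> Obj C \<Longrightarrow> Cod C (Ident C A) = A"
    and Comp_in: "\<lbrakk>f \<in> Arr C; g \<in> Arr C; Cod C f = Dom C g\<rbrakk> \<Longrightarrow> Comp C f g \<in> Arr C"
    and Dom_Comp: "\<lbrakk>f \<in> Arr C; g \<in> Arr C; Cod C f = Dom C g\<rbrakk> \<Longrightarrow> Dom C (Comp C f g) = Dom C f"
    and Cod_Comp: "\<lbrakk>f \<in> Arr C; g \<in> Arr C; Cod C f = Dom C g\<rbrakk> \<Longrightarrow> Cod C (Comp C f g) = Cod C g"
    and Ident_Comp: "f \<in> Arr C \<Longrightarrow> Comp C (Ident C (Dom C f)) f = f"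
    and Comp_Ident: "f \<in> Arr C \<Longrightarrow> Comp C f (Ident C (Cod C f)) = f"
    and Comp_assoc: "\<lbrakk>f \<in> Arr C; g \<in> Arr C; h \<in> Arr C; Cod C f = Dom C g; Cod C g = Dom C h\<rbrakk>
      \<Longrightarrow> Comp C (Comp C f g) h = Comp C f (Comp C g h)"

text \<open>
  Functors are required to be \<^const>\<open>extensional\<close> (i.e. \<^const>\<open>undefined\<close> outside the
  carriers), so that HOL equality of the records below is equality of functors.  The same
  convention is used for functors of operads.
\<close>

record ('o, 'a, 'p, 'b) cat_functor =
  obj_map :: "'o \<Rightarrow> 'p"
  arr_map :: "'a \<Rightarrow> 'b"

locale cat_functor = dom: category C + cod: category D
  for C :: "('o, 'a) category" and D :: "('p, 'b) category" +
  fixes F :: "('o, 'a, 'p, 'b) cat_functor"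
  assumes obj_map_in: "obj_map F \<in> Obj C \<rightarrow>\<^sub>E Obj D"
    and arr_map_in: "arr_map F \<in> Arr C \<rightarrow>\<^sub>E Arr D"
    and Dom_map: "f \<in> Arr C \<Longrightarrow> Dom D (arr_map F f) = obj_map F (Dom C f)"
    and Cod_map: "f \<in> Arr C \<Longrightarrow> Cod D (arr_map F f) = obj_map F (Cod C f)"
    and Ident_map: "A \<in> Obj C \<Longrightarrow> arr_map F (Ident C A) = Ident D (obj_map F A)"
    and Comp_map: "\<lbrakk>f \<in> Arr C; g \<in> Arr C; Cod C f = Dom C g\<rbrakk>
      \<Longrightarrow> arr_map F (Comp C f g) = Comp D (arr_map F f) (arr_map F g)"

inductive_set generated_arrows :: "('o, 'a) category \<Rightarrow> 'a set \<Rightarrow> 'a set"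
  for C :: "('o, 'a) category" and X :: "'a set" where
  ident: "A \<in> Obj C \<Longrightarrow> Ident C A \<in> generated_arrows C X"
| gen: "f \<in> X \<Longrightarrow> f \<in> generated_arrows C X"
| comp: "\<lbrakk>f \<in> generated_arrows C X; g \<in> generated_arrows C X; Cod C f = Dom C g\<rbrakk>
    \<Longrightarrow> Comp C f g \<in> generated_arrows C X"

definition finitely_generated :: "('o, 'a) category \<Rightarrow> bool" where
  "finitely_generated C \<longleftrightarrow>
     finite (Obj C) \<and> (\<exists>X. finite X \<and> X \<subseteq> Arr C \<and> Arr C \<subseteq> generated_arrows C X)"


section \<open>Colored non-symmetric operads\<close>

text \<open>
  \<open>op_comp P f [g\<^sub>1, \<dots>, g\<^sub>n]\<close> plugs \<open>g\<^sub>i\<close> into the \<open>i\<close>-th input of the \<open>n\<close>-ary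
  operation \<open>f\<close>, for all \<open>i\<close> simultaneously.
\<close>

record ('c, 'f) operad =
  Colors :: "'c set"
  Ops :: "'f set"
  op_ins :: "'f \<Rightarrow> 'c list"
  op_out :: "'f \<Rightarrow> 'c"
  op_id :: "'c \<Rightarrow> 'f"
  op_comp :: "'f \<Rightarrow> 'f list \<Rightarrow> 'f"

definition composable :: "('c, 'f) operad \<Rightarrow> 'f \<Rightarrow> 'f list \<Rightarrow> bool" where
  "composable P f gs \<longleftrightarrow> f \<in> Ops P \<and> set gs \<subseteq> Ops P \<and> map (op_out P) gs = op_ins P f"

locale operad =
  fixes P :: "('c, 'f) operad"
  assumes inputs_in: "f \<in> Ops P \<Longrightarrow> set (op_ins P f) \<subseteq> Colors P"
    and output_in: "f \<in> Ops P \<Longrightarrow> op_out P f \<in> Colors P"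
    and id_in: "R \<in> Colors P \<Longrightarrow> op_id P R \<in> Ops P"
    and inputs_id: "R \<in> Colors P \<Longrightarrow> op_ins P (op_id P R) = [R]"
    and output_id: "R \<in> Colors P \<Longrightarrow> op_out P (op_id P R) = R"
    and comp_in: "composable P f gs \<Longrightarrow> op_comp P f gs \<in> Ops P"
    and inputs_comp: "composable P f gs \<Longrightarrow> op_ins P (op_comp P f gs) = concat (map (op_ins P) gs)"
    and output_comp: "composable P f gs \<Longrightarrow> op_out P (op_comp P f gs) = op_out P f"
    and id_comp: "f \<in> Ops P \<Longrightarrow> op_comp P (op_id P (op_out P f)) [f] = f"
    and comp_id: "f \<in> Ops P \<Longrightarrow> op_comp P f (map (op_id P) (op_ins P f)) = f"
    and comp_assoc: "\<lbrakk>composable P f gs; list_all2 (composable P) gs hss\<rbrakk>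
      \<Longrightarrow> op_comp P (op_comp P f gs) (concat hss) = op_comp P f (map2 (op_comp P) gs hss)"

record ('c, 'f, 'd, 'g) operad_functor =
  col_map :: "'c \<Rightarrow> 'd"
  op_map :: "'f \<Rightarrow> 'g"

locale operad_functor = dom: operad P + cod: operad Q
  for P :: "('c, 'f) operad" and Q :: "('d, 'g) operad" +
  fixes F :: "('c, 'f, 'd, 'g) operad_functor"
  assumes col_map_in: "col_map F \<in> Colors P \<rightarrow>\<^sub>E Colors Q"
    and op_map_in: "op_map F \<in> Ops P \<rightarrow>\<^sub>E Ops Q"
    and inputs_map: "f \<in> Ops P \<Longrightarrow> op_ins Q (op_map F f) = map (col_map F) (op_ins P f)"
    and output_map: "f \<in> Ops P \<Longrightarrow> op_out Q (op_map F f) = col_map F (op_out P f)"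
    and id_map: "R \<in> Colors P \<Longrightarrow> op_map F (op_id P R) = op_id Q (col_map F R)"
    and comp_map: "composable P f gs
      \<Longrightarrow> op_map F (op_comp P f gs) = op_comp Q (op_map F f) (map (op_map F) gs)"

text \<open>The argument \<open>P\<close> is the domain of the composite; \<open>F\<close> is applied first.\<close>

definition operad_functor_comp ::
  "('c, 'f) operad \<Rightarrow> ('d, 'g, 'e, 'h) operad_functor \<Rightarrow> ('c, 'f, 'd, 'g) operad_functor
    \<Rightarrow> ('c, 'f, 'e, 'h) operad_functor" where
  "operad_functor_comp P G F =
     \<lparr>col_map = compose (Colors P) (col_map G) (col_map F),
      op_map = compose (Ops P) (op_map G) (op_map F)\<rparr>"

definition constants :: "('c, 'f) operad \<Rightarrow> 'c \<Rightarrow> 'f set" where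
  "constants P R = {\<alpha> \<in> Ops P. op_ins P \<alpha> = [] \<and> op_out P \<alpha> = R}"


section \<open>Species and free operads\<close>

record ('c, 'v) species =
  sp_colors :: "'c set"
  sp_nodes :: "'v set"
  sp_in :: "'v \<Rightarrow> 'c list"
  sp_out :: "'v \<Rightarrow> 'c"

locale species =
  fixes S :: "('c, 'v) species"
  assumes sp_in_colors: "x \<in> sp_nodes S \<Longrightarrow> set (sp_in S x) \<subseteq> sp_colors S"
    and sp_out_colors: "x \<in> sp_nodes S \<Longrightarrow> sp_out S x \<in> sp_colors S"

locale finite_species = species +
  assumes finite_colors: "finite (sp_colors S)"
    and finite_nodes: "finite (sp_nodes S)"

text \<open>
  Operations of the free operad are the well-colored trees whose inner vertices are labelled by
  nodes.  \<^term>\<open>Leaf R\<close> is an open input of color \<open>R\<close>; a constant is a tree without leaves.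
\<close>

datatype ('c, 'v) tree = Leaf 'c | Node 'v "('c, 'v) tree list"

primrec leaves :: "('c, 'v) tree \<Rightarrow> 'c list" where
  "leaves (Leaf R) = [R]"
| "leaves (Node x ts) = concat (map leaves ts)"

primrec root :: "('c, 'v) species \<Rightarrow> ('c, 'v) tree \<Rightarrow> 'c" where
  "root S (Leaf R) = R"
| "root S (Node x ts) = sp_out S x"

inductive_set trees :: "('c, 'v) species \<Rightarrow> ('c, 'v) tree set"
  for S :: "('c, 'v) species" where
  Leaf: "R \<in> sp_colors S \<Longrightarrow> Leaf R \<in> trees S"
| Node: "\<lbrakk>x \<in> sp_nodes S; \<forall>t \<in> set ts. t \<in> trees S; map (root S) ts = sp_in S x\<rbrakk>
    \<Longrightarrow> Node x ts \<in> trees S"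

primrec chunks :: "nat list \<Rightarrow> 'a list \<Rightarrow> 'a list list" where
  "chunks [] us = []"
| "chunks (n # ns) us = take n us # chunks ns (drop n us)"

text \<open>\<^term>\<open>graft t us\<close> replaces the leaves of \<open>t\<close>, from left to right, by the trees \<open>us\<close>.\<close>

primrec graft :: "('c, 'v) tree \<Rightarrow> ('c, 'v) tree list \<Rightarrow> ('c, 'v) tree" where
  "graft (Leaf R) = hd"
| "graft (Node x ts) =
     (\<lambda>us. Node x (map2 (\<lambda>g vs. g vs) (map graft ts) (chunks (map (length \<circ> leaves) ts) us)))"

definition Free :: "('c, 'v) species \<Rightarrow> ('c, ('c, 'v) tree) operad" where
  "Free S = \<lparr>Colors = sp_colors S, Ops = trees S, op_ins = leaves, op_out = root S,
             op_id = Leaf, op_comp = graft\<rparr>"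

text \<open>
  The extension of an assignment \<open>c\<close> of colors and \<open>v\<close> of operations to nodes to a functor
  of operads on the free operad; see \<open>Free_ext_unique\<close> below.
\<close>

primrec tree_ext ::
  "('d, 'g) operad \<Rightarrow> ('c \<Rightarrow> 'd) \<Rightarrow> ('v \<Rightarrow> 'g) \<Rightarrow> ('c, 'v) tree \<Rightarrow> 'g" where
  "tree_ext Q c v (Leaf R) = op_id Q (c R)"
| "tree_ext Q c v (Node x ts) = op_comp Q (v x) (map (tree_ext Q c v) ts)"

definition Free_ext ::
  "('c, 'v) species \<Rightarrow> ('d, 'g) operad \<Rightarrow> ('c \<Rightarrow> 'd) \<Rightarrow> ('v \<Rightarrow> 'g)
    \<Rightarrow> ('c, ('c, 'v) tree, 'd, 'g) operad_functor" where
  "Free_ext S Q c v =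
     \<lparr>col_map = restrict c (Colors (Free S)), op_map = restrict (tree_ext Q c v) (Ops (Free S))\<rparr>"

definition corolla :: "('c, 'v) species \<Rightarrow> 'v \<Rightarrow> ('c, 'v) tree" where
  "corolla S x = Node x (map Leaf (sp_in S x))"


section \<open>The operad of spliced arrows\<close>

text \<open>
  A spliced arrow \<open>w\<^sub>0 - \<dots> - w\<^sub>n\<close> is the list \<open>[w\<^sub>0, \<dots>, w\<^sub>n]\<close>.  Any non-empty list of arrows
  qualifies, and it determines its colors: the \<open>i\<close>-th gap has color \<open>(Cod w\<^sub>i\<^sub>-\<^sub>1, Dom w\<^sub>i)\<close> and the
  output color is \<open>(Dom w\<^sub>0, Cod w\<^sub>n)\<close>.
\<close>

definition juxtapose :: "('o, 'a) category \<Rightarrow> 'a list \<Rightarrow> 'a list \<Rightarrow> 'a list" where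
  "juxtapose C us ws = butlast us @ Comp C (last us) (hd ws) # tl ws"

fun fill_gaps :: "('o, 'a) category \<Rightarrow> 'a list \<Rightarrow> 'a list list \<Rightarrow> 'a list" where
  "fill_gaps C (w # ws) (us # uss) = juxtapose C (juxtapose C [w] us) (fill_gaps C ws uss)"
| "fill_gaps C ws uss = ws"

definition Spliced :: "('o, 'a) category \<Rightarrow> ('o \<times> 'o, 'a list) operad" where
  "Spliced C = \<lparr>Colors = Obj C \<times> Obj C,
                Ops = {ws. ws \<noteq> [] \<and> set ws \<subseteq> Arr C},
                op_ins = (\<lambda>ws. zip (map (Cod C) (butlast ws)) (map (Dom C) (tl ws))),
                op_out = (\<lambda>ws. (Dom C (hd ws), Cod C (last ws))),
                op_id = (\<lambda>(A, B). [Ident C A, Ident C B]),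
                op_comp = fill_gaps C\<rparr>"

text \<open>\<open>Spliced_map C F\<close> is \<open>W[F]\<close>, where \<open>C\<close> is the domain of \<open>F\<close>.\<close>

definition Spliced_map ::
  "('o, 'a) category \<Rightarrow> ('o, 'a, 'p, 'b) cat_functor
    \<Rightarrow> ('o \<times> 'o, 'a list, 'p \<times> 'p, 'b list) operad_functor" where
  "Spliced_map C F =
     \<lparr>col_map = restrict (map_prod (obj_map F) (obj_map F)) (Colors (Spliced C)),
      op_map = restrict (map (arr_map F)) (Ops (Spliced C))\<rparr>"


section \<open>Context-free grammars of arrows\<close>

record ('o, 'a, 'c, 'v) grammar =
  gr_cat :: "('o, 'a) category"
  gr_species :: "('c, 'v) species"
  gr_start :: "'c"
  gr_proj :: "('c, ('c, 'v) tree, 'o \<times> 'o, 'a list) operad_functor"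

locale cf_grammar =
  fixes G :: "('o, 'a, 'c, 'v) grammar"
  assumes category: "category (gr_cat G)"
    and finitely_generated: "finitely_generated (gr_cat G)"
    and finite_species: "finite_species (gr_species G)"
    and start: "gr_start G \<in> sp_colors (gr_species G)"
    and proj: "operad_functor (Free (gr_species G)) (Spliced (gr_cat G)) (gr_proj G)"

text \<open>Constants of \<^term>\<open>Spliced C\<close> are singleton lists \<open>[w]\<close>, identified with the arrow \<open>w\<close>.\<close>

definition language :: "('o, 'a, 'c, 'v) grammar \<Rightarrow> 'a set" where
  "language G = {w. \<exists>\<alpha> \<in> constants (Free (gr_species G)) (gr_start G). op_map (gr_proj G) \<alpha> = [w]}"


section \<open>Free categories and the contour category\<close>

record ('o, 'e) graph =
  verts :: "'o set"
  edges :: "'e set"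
  src :: "'e \<Rightarrow> 'o"
  tgt :: "'e \<Rightarrow> 'o"

primrec path :: "('o, 'e) graph \<Rightarrow> 'o \<Rightarrow> 'e list \<Rightarrow> 'o \<Rightarrow> bool" where
  "path g A [] B \<longleftrightarrow> A \<in> verts g \<and> A = B"
| "path g A (e # es) B \<longleftrightarrow> A \<in> verts g \<and> e \<in> edges g \<and> src g e = A \<and> path g (tgt g e) es B"

definition Free_cat :: "('o, 'e) graph \<Rightarrow> ('o, 'o \<times> 'e list \<times> 'o) category" where
  "Free_cat g = \<lparr>Obj = verts g,
                 Arr = {(A, es, B). path g A es B},
                 Dom = (\<lambda>(A, es, B). A),
                 Cod = (\<lambda>(A, es, B). B),
                 Ident = (\<lambda>A. (A, [], A)),
                 Comp = (\<lambda>(A, es, B) (A', es', B'). (A, es @ es', B'))\<rparr>"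

definition gen_arrow :: "('o, 'e) graph \<Rightarrow> 'e \<Rightarrow> 'o \<times> 'e list \<times> 'o" where
  "gen_arrow g e = (src g e, [e], tgt g e)"

text \<open>\<open>Up R\<close> and \<open>Down R\<close> stand for \<open>R\<^sup>u\<close> and \<open>R\<^sup>d\<close>.\<close>

datatype 'c oriented = Up 'c | Down 'c

text \<open>
  The edge \<open>(x, i)\<close> goes from \<open>R\<^sub>i\<^sup>d\<close> to \<open>R\<^sub>i\<^sub>+\<^sub>1\<^sup>u\<close>, where \<open>R\<^sub>0\<^sup>d = R\<^sup>u\<close> and \<open>R\<^sub>n\<^sub>+\<^sub>1\<^sup>u = R\<^sup>d\<close>; the
  \<open>i\<close>-th input color \<open>R\<^sub>i\<close> is the list element at position \<open>i - 1\<close>.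
\<close>

definition contour_graph :: "('c, 'v) species \<Rightarrow> ('c oriented, 'v \<times> nat) graph" where
  "contour_graph S =
     \<lparr>verts = Up ` sp_colors S \<union> Down ` sp_colors S,
      edges = {(x, i). x \<in> sp_nodes S \<and> i \<le> length (sp_in S x)},
      src = (\<lambda>(x, i). if i = 0 then Up (sp_out S x) else Down (sp_in S x ! (i - 1))),
      tgt = (\<lambda>(x, i). if i = length (sp_in S x) then Down (sp_out S x) else Up (sp_in S x ! i))\<rparr>"

type_synonym ('c, 'v) contour_arrow = "'c oriented \<times> ('v \<times> nat) list \<times> 'c oriented"

definition contour_cat :: "('c, 'v) species \<Rightarrow> ('c oriented, ('c, 'v) contour_arrow) category" where
  "contour_cat S = Free_cat (contour_graph S)"

definition contour_colors :: "'c \<Rightarrow> 'c oriented \<times> 'c oriented" where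
  "contour_colors R = (Up R, Down R)"

definition contour_node :: "('c, 'v) species \<Rightarrow> 'v \<Rightarrow> ('c, 'v) contour_arrow list" where
  "contour_node S x = map (\<lambda>i. gen_arrow (contour_graph S) (x, i)) [0..<length (sp_in S x) + 1]"

definition contour_proj ::
  "('c, 'v) species \<Rightarrow>
    ('c, ('c, 'v) tree, 'c oriented \<times> 'c oriented, ('c, 'v) contour_arrow list) operad_functor" where
  "contour_proj S = Free_ext S (Spliced (contour_cat S)) contour_colors (contour_node S)"

definition Univ ::
  "('c, 'v) species \<Rightarrow> 'c \<Rightarrow> ('c oriented, ('c, 'v) contour_arrow, 'c, 'v) grammar" where
  "Univ S s = \<lparr>gr_cat = contour_cat S, gr_species = S, gr_start = s, gr_proj = contour_proj S\<rparr>"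


section \<open>The free operad and its universal property\<close>

lemma length_chunks [simp]: "length (chunks ns us) = length ns"
  by (induction ns arbitrary: us) auto

lemma chunks_concat [simp]: "chunks (map length uss) (concat uss) = uss"
  by (induction uss) auto

lemma concat_concat: "concat (concat xsss) = concat (map concat xsss)"
  by (induction xsss) auto

lemma concat_map2_map2:
  assumes "map length uss = map length vsss"
  shows "map2 f (concat uss) (concat vsss) = concat (map2 (map2 f) uss vsss)"
proof -
  have "length uss = length vsss"
    using assms by (metis length_map)
  then show ?thesis
    using assms by (induction uss vsss rule: list_induct2) auto
qed

lemma map_eq_concat_split:
  assumes "map r us = concat lss"
  obtains uss where "us = concat uss" "map (map r) uss = lss"
  using assms
proof (induction lss arbitrary: us thesis)
  case Nil
  then show ?case by auto
next
  case (Cons ls lss)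
  then obtain us1 us2 where us: "us = us1 @ us2" "map r us1 = ls" "map r us2 = concat lss"
    by (auto simp: map_eq_append_conv)
  with Cons.IH obtain uss where "us2 = concat uss" "map (map r) uss = lss"
    by blast
  with us show ?case
    by (intro Cons.prems(1)[of "us1 # uss"]) auto
qed

lemma length_eq_concat_split:
  assumes "length us = sum_list ns"
  obtains uss where "us = concat uss" "map length uss = ns"
proof -
  have "map (\<lambda>_. ()) us = concat (map (\<lambda>n. replicate n ()) ns)"
    using assms by (intro nth_equalityI) (auto simp: length_concat o_def)
  then obtain uss where uss: "us = concat uss"
    "map (map (\<lambda>_. ())) uss = map (\<lambda>n. replicate n ()) ns"
    by (rule map_eq_concat_split)
  from uss(2) have "map length (map (map (\<lambda>_. ())) uss) = map length (map (\<lambda>n. replicate n ()) ns)"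
    by (rule arg_cong)
  then have "map length uss = ns"
    by (simp add: o_def)
  with uss(1) that show thesis by blast
qed

lemma Leaf_in_trees [simp]: "Leaf R \<in> trees S \<longleftrightarrow> R \<in> sp_colors S"
  by (auto elim: trees.cases intro: trees.Leaf)

lemma Node_in_trees [simp]:
  "Node x ts \<in> trees S \<longleftrightarrow> x \<in> sp_nodes S \<and> set ts \<subseteq> trees S \<and> map (root S) ts = sp_in S x"
  by (auto elim: trees.cases intro!: trees.Node)

lemma leaves_Node_split:
  assumes "length us = length (leaves (Node x ts))"
  obtains uss where "us = concat uss" "map length uss = map (length \<circ> leaves) ts"
    "length uss = length ts"
proof -
  have "length us = sum_list (map (length \<circ> leaves) ts)"
    using assms by (simp add: length_concat o_def)
  then obtain uss where "us = concat uss" "map length uss = map (length \<circ> leaves) ts"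
    by (rule length_eq_concat_split)
  then show thesis
    using that by (metis length_map)
qed

lemma graft_Node_concat:
  assumes "map length uss = map (length \<circ> leaves) ts"
  shows "graft (Node x ts) (concat uss) = Node x (map2 graft ts uss)"
proof -
  have "length ts = length uss"
    using assms by (metis length_map)
  moreover have "chunks (map (length \<circ> leaves) ts) (concat uss) = uss"
    by (metis assms chunks_concat)
  ultimately show ?thesis
    by (simp add: zip_map1 case_prod_unfold o_def)
qed

lemma leaves_graft:
  "length us = length (leaves t) \<Longrightarrow> leaves (graft t us) = concat (map leaves us)"
proof (induction t arbitrary: us)
  case (Leaf R)
  then show ?case by (cases us) auto
next
  case (Node x ts)
  from Node.prems obtain uss where us: "us = concat uss"
    and len: "map length uss = map (length \<circ> leaves) ts" "length uss = length ts"
    by (rule leaves_Node_split)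
  then have "map (leaves \<circ> (\<lambda>(t, us). graft t us)) (zip ts uss) = map (concat \<circ> map leaves) uss"
    using Node.IH by (intro nth_equalityI) (auto simp: list_eq_iff_nth_eq)
  then show ?case
    by (simp add: us graft_Node_concat[OF len(1)] map_concat concat_concat o_def del: graft.simps)
qed

lemma root_graft: "map (root S) us = leaves t \<Longrightarrow> root S (graft t us) = root S t"
  by (cases t; cases us) auto

lemma graft_in_trees:
  "\<lbrakk>t \<in> trees S; set us \<subseteq> trees S; map (root S) us = leaves t\<rbrakk> \<Longrightarrow> graft t us \<in> trees S"
proof (induction t arbitrary: us)
  case (Leaf R)
  then show ?case by (cases us) auto
next
  case (Node x ts)
  from Node.prems(3) obtain uss where us: "us = concat uss" "map (map (root S)) uss = map leaves ts"
    by (auto elim: map_eq_concat_split)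
  then have len: "length uss = length ts"
    by (metis length_map)
  have eq: "map (root S) (uss ! i) = leaves (ts ! i)" if "i < length ts" for i
    using us(2) len that by (metis nth_map)
  then have lens: "map length uss = map (length \<circ> leaves) ts"
    using len by (intro nth_equalityI) (auto, metis length_map)
  have "graft (ts ! i) (uss ! i) \<in> trees S" if "i < length ts" for i
  proof (rule Node.IH)
    show "ts ! i \<in> set ts" using that by simp
    then show "ts ! i \<in> trees S" using Node.prems(1) by auto
    show "set (uss ! i) \<subseteq> trees S" using Node.prems(2) us(1) that len by fastforce
  qed (use eq that in blast)
  moreover have "map (root S) (map2 graft ts uss) = map (root S) ts"
    using len eq by (intro nth_equalityI) (auto simp: root_graft)
  ultimately show ?case
    using Node.prems(1) len
    by (auto simp: us(1) graft_Node_concat[OF lens] in_set_zip simp del: graft.simps)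
qed

lemma graft_Leaves: "graft t (map Leaf (leaves t)) = t"
proof (induction t)
  case (Leaf R)
  then show ?case by simp
next
  case (Node x ts)
  have "graft (Node x ts) (concat (map (map Leaf \<circ> leaves) ts))
    = Node x (map2 graft ts (map (map Leaf \<circ> leaves) ts))"
    by (rule graft_Node_concat) simp
  moreover have "map2 graft ts (map (map Leaf \<circ> leaves) ts) = ts"
    using Node.IH by (intro nth_equalityI) auto
  ultimately show ?case
    by (simp add: map_concat del: graft.simps)
qed

lemma graft_assoc:
  "\<lbrakk>length us = length (leaves t); map length vss = map (length \<circ> leaves) us\<rbrakk>
    \<Longrightarrow> graft (graft t us) (concat vss) = graft t (map2 graft us vss)"
proof (induction t arbitrary: us vss)
  case (Leaf R)
  then show ?case by (cases us; cases vss) auto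
next
  case (Node x ts)
  from Node.prems(1) obtain uss where us: "us = concat uss"
    and len: "map length uss = map (length \<circ> leaves) ts" "length uss = length ts"
    by (rule leaves_Node_split)
  have "map length vss = concat (map (map (length \<circ> leaves)) uss)"
    unfolding Node.prems(2) us by (simp only: map_concat)
  then obtain vsss where vss: "vss = concat vsss"
    "map (map length) vsss = map (map (length \<circ> leaves)) uss"
    by (rule map_eq_concat_split)
  then have len': "length vsss = length uss"
    by (metis length_map)
  have eq: "map length (vsss ! i) = map (length \<circ> leaves) (uss ! i)" if "i < length ts" for i
    using vss(2) len(2) len' that by (metis nth_map)
  then have eq_len: "length (vsss ! i) = length (uss ! i)" if "i < length ts" for i
    using that by (metis length_map)
  have eq_len1: "length (uss ! i) = length (leaves (ts ! i))" if "i < length ts" for i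
    using len that by (metis comp_apply nth_map)
  have lens: "map length uss = map length vsss"
    using len(2) len' eq_len by (intro nth_equalityI) auto
  have lens2: "map length (map concat vsss) = map (length \<circ> leaves) (map2 graft ts uss)"
    using len(2) len' eq eq_len1
    by (intro nth_equalityI) (auto simp: leaves_graft length_concat o_def)
  have lens3: "map length (map2 (map2 graft) uss vsss) = map (length \<circ> leaves) ts"
    using len(2) len' by (intro nth_equalityI) (auto simp: eq_len eq_len1)
  have "graft (graft (Node x ts) us) (concat vss)
    = Node x (map2 graft (map2 graft ts uss) (map concat vsss))"
    using graft_Node_concat[OF len(1)] graft_Node_concat[OF lens2]
    by (simp add: us vss(1) concat_concat del: graft.simps)
  also have "map2 graft (map2 graft ts uss) (map concat vsss)
    = map2 graft ts (map2 (map2 graft) uss vsss)"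
    using len(2) len' eq eq_len1 Node.IH by (intro nth_equalityI) auto
  also have "Node x \<dots> = graft (Node x ts) (map2 graft us vss)"
    using graft_Node_concat[OF lens3]
    by (simp add: us vss(1) concat_map2_map2[OF lens] del: graft.simps)
  finally show ?case .
qed

lemma root_in_colors:
  assumes "species S" "t \<in> trees S"
  shows "root S t \<in> sp_colors S"
  using assms by (cases t) (auto intro: species.sp_out_colors)

lemma leaves_in_colors: "t \<in> trees S \<Longrightarrow> set (leaves t) \<subseteq> sp_colors S"
  by (induction t) auto

lemma composable_lengths:
  assumes "list_all2 (composable (Free S)) us vss"
  shows "map length vss = map (length \<circ> leaves) us"
proof -
  have "length vs = length (leaves u)" if "composable (Free S) u vs" for u vs
    using that by (auto simp: composable_def Free_def dest: arg_cong[of _ _ length])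
  then have "list_all2 (\<lambda>u vs. length vs = length (leaves u)) us vss"
    using assms by (auto elim: list_all2_mono)
  then show ?thesis
    by (induction rule: list_all2_induct) auto
qed

lemma operad_Free:
  assumes "species S"
  shows "operad (Free S)"
proof
  fix t us vss
  assume "composable (Free S) t us" "list_all2 (composable (Free S)) us vss"
  then show "op_comp (Free S) (op_comp (Free S) t us) (concat vss) =
      op_comp (Free S) t (map2 (op_comp (Free S)) us vss)"
    using graft_assoc[of us t vss] composable_lengths[of S us vss]
    by (auto simp: Free_def composable_def dest: arg_cong[of _ _ length])
next
  fix t us
  assume "composable (Free S) t us"
  then show "op_ins (Free S) (op_comp (Free S) t us) = concat (map (op_ins (Free S)) us)"
    using leaves_graft[of us t]
    by (auto simp: Free_def composable_def dest: arg_cong[of _ _ length])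
qed (use assms in \<open>auto simp: Free_def composable_def root_graft graft_in_trees graft_Leaves
       root_in_colors dest: leaves_in_colors\<close>)

locale free_assignment = species S + operad Q
  for S :: "('c, 'v) species" and Q :: "('d, 'g) operad" +
  fixes c :: "'c \<Rightarrow> 'd" and v :: "'v \<Rightarrow> 'g"
  assumes c_in: "R \<in> sp_colors S \<Longrightarrow> c R \<in> Colors Q"
    and v_in: "x \<in> sp_nodes S \<Longrightarrow> v x \<in> Ops Q"
    and op_ins_v: "x \<in> sp_nodes S \<Longrightarrow> op_ins Q (v x) = map c (sp_in S x)"
    and op_out_v: "x \<in> sp_nodes S \<Longrightarrow> op_out Q (v x) = c (sp_out S x)"
begin

lemma tree_ext_types:
  "t \<in> trees S \<Longrightarrow> tree_ext Q c v t \<in> Ops Q \<and> op_ins Q (tree_ext Q c v t) = map c (leaves t) \<and>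
     op_out Q (tree_ext Q c v t) = c (root S t)"
proof (induction t)
  case (Leaf R)
  then show ?case by (simp add: c_in id_in inputs_id output_id)
next
  case (Node x ts)
  have "map (op_out Q \<circ> tree_ext Q c v) ts = map (c \<circ> root S) ts"
    using Node by auto
  then have "composable Q (v x) (map (tree_ext Q c v) ts)"
    using Node by (auto simp: composable_def v_in op_ins_v simp flip: map_map)
  moreover have "map (op_ins Q \<circ> tree_ext Q c v) ts = map (map c \<circ> leaves) ts"
    using Node by auto
  ultimately show ?case
    using Node.prems
    by (simp add: comp_in inputs_comp output_comp op_out_v map_concat del: map_eq_conv)
qed

lemma composable_tree_ext:
  "composable (Free S) t us \<Longrightarrow> composable Q (tree_ext Q c v t) (map (tree_ext Q c v) us)"
proof -
  assume "composable (Free S) t us"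
  then have *: "t \<in> trees S" "set us \<subseteq> trees S" "map (root S) us = leaves t"
    by (simp_all add: composable_def Free_def)
  from *(2) have "map (op_out Q) (map (tree_ext Q c v) us) = map c (map (root S) us)"
    by (auto simp: tree_ext_types subset_iff)
  also have "\<dots> = op_ins Q (tree_ext Q c v t)"
    using * by (simp add: tree_ext_types)
  finally show ?thesis
    unfolding composable_def by (intro conjI) (use * in \<open>auto simp: tree_ext_types simp del: map_map\<close>)
qed

lemma tree_ext_graft:
  "composable (Free S) t us
    \<Longrightarrow> tree_ext Q c v (graft t us) = op_comp Q (tree_ext Q c v t) (map (tree_ext Q c v) us)"
proof (induction t arbitrary: us)
  case (Leaf R)
  then obtain u where "us = [u]" "u \<in> trees S" "root S u = R"
    by (auto simp: composable_def Free_def)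
  then show ?case using tree_ext_types[of u] id_comp by fastforce
next
  case (Node x ts)
  let ?e = "tree_ext Q c v"
  have ts: "Node x ts \<in> trees S"
    using Node.prems by (simp add: composable_def Free_def)
  from Node.prems obtain uss
    where us: "us = concat uss" "map (map (root S)) uss = map leaves ts"
    by (auto simp: composable_def Free_def elim: map_eq_concat_split)
  then have len: "length uss = length ts"
    by (metis length_map)
  have eq: "map (root S) (uss ! i) = leaves (ts ! i)" if "i < length ts" for i
    using us(2) len that by (metis nth_map)
  then have lens: "map length uss = map (length \<circ> leaves) ts"
    using len by (intro nth_equalityI) (auto, metis length_map)
  have comp: "composable (Free S) (ts ! i) (uss ! i)" if "i < length ts" for i
  proof -
    have "uss ! i \<in> set uss" "ts ! i \<in> set ts"
      using that len by auto
    moreover have "\<Union> (set ` set uss) \<subseteq> trees S"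
      using Node.prems us(1) by (simp add: composable_def Free_def)
    ultimately show ?thesis
      using eq[OF that] ts by (auto simp: composable_def Free_def)
  qed
  have "set ts \<subseteq> trees S"
    using ts by simp
  then have "map (op_out Q) (map ?e ts) = map c (map (root S) ts)"
    by (auto simp: tree_ext_types subset_iff)
  also have "\<dots> = op_ins Q (v x)"
    using ts by (simp add: op_ins_v)
  finally have c1: "composable Q (v x) (map ?e ts)"
    unfolding composable_def
    by (intro conjI) (use ts in \<open>auto simp: tree_ext_types v_in simp del: map_map\<close>)
  have c2: "list_all2 (composable Q) (map ?e ts) (map (map ?e) uss)"
    using comp len by (auto simp: list_all2_conv_all_nth composable_tree_ext)
  have "?e (graft (Node x ts) us) = op_comp Q (v x) (map ?e (map2 graft ts uss))"
    by (simp add: us(1) graft_Node_concat[OF lens] del: graft.simps)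
  also have "map ?e (map2 graft ts uss) = map2 (op_comp Q) (map ?e ts) (map (map ?e) uss)"
    using len comp Node.IH by (intro nth_equalityI) auto
  also have "op_comp Q (v x) \<dots> = op_comp Q (op_comp Q (v x) (map ?e ts)) (concat (map (map ?e) uss))"
    by (rule comp_assoc[OF c1 c2, symmetric])
  finally show ?case
    by (simp add: us(1) map_concat)
qed

lemma operad_functor_Free_ext: "operad_functor (Free S) Q (Free_ext S Q c v)"
proof -
  interpret free: operad "Free S"
    by (intro operad_Free) unfold_locales
  show ?thesis
  proof
    fix t us
    assume *: "composable (Free S) t us"
    then have "graft t us \<in> trees S" "t \<in> trees S" "set us \<subseteq> trees S"
      using free.comp_in[OF *] by (auto simp: composable_def Free_def)
    moreover from this have "map (restrict (tree_ext Q c v) (trees S)) us = map (tree_ext Q c v) us"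
      by auto
    ultimately show "op_map (Free_ext S Q c v) (op_comp (Free S) t us) =
        op_comp Q (op_map (Free_ext S Q c v) t) (map (op_map (Free_ext S Q c v)) us)"
      using tree_ext_graft[OF *] by (simp add: Free_ext_def Free_def del: map_eq_conv)
  next
    fix t assume "t \<in> Ops (Free S)"
    then have "t \<in> trees S" by (simp add: Free_def)
    then have "map (restrict c (sp_colors S)) (leaves t) = map c (leaves t)"
      using leaves_in_colors[of t S] by auto
    with \<open>t \<in> trees S\<close> show "op_ins Q (op_map (Free_ext S Q c v) t)
        = map (col_map (Free_ext S Q c v)) (op_ins (Free S) t)"
      by (simp add: Free_ext_def Free_def tree_ext_types)
  qed (auto simp: Free_ext_def Free_def tree_ext_types c_in root_in_colors[OF species_axioms])
qed

lemma Free_ext_corolla: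
  assumes "x \<in> sp_nodes S"
  shows "op_map (Free_ext S Q c v) (corolla S x) = v x"
proof -
  have "map (\<lambda>R. op_id Q (c R)) (sp_in S x) = map (op_id Q) (op_ins Q (v x))"
    using assms by (simp add: op_ins_v)
  then show ?thesis
    using assms sp_in_colors[OF assms] comp_id[OF v_in[OF assms]]
    by (auto simp: Free_ext_def Free_def corolla_def o_def)
qed

lemma Free_ext_unique:
  assumes F: "operad_functor (Free S) Q F"
    and col: "\<And>R. R \<in> sp_colors S \<Longrightarrow> col_map F R = c R"
    and node: "\<And>x. x \<in> sp_nodes S \<Longrightarrow> op_map F (corolla S x) = v x"
  shows "F = Free_ext S Q c v"
proof -
  interpret F: operad_functor "Free S" Q F by (rule F)
  have "op_map F t = tree_ext Q c v t" if "t \<in> trees S" for t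
    using that
  proof (induction t rule: tree.induct)
    case (Leaf R)
    then show ?case using F.id_map[of R] col by (simp add: Free_def)
  next
    case (Node x ts)
    have "map (root S) ts = sp_in S x"
      using Node.prems by simp
    then have "length (sp_in S x) = length ts"
      by (metis length_map)
    then have len: "map length (map (\<lambda>t. [t]) ts) = map (length \<circ> leaves) (map Leaf (sp_in S x))"
      by (intro nth_equalityI) auto
    have 1: "graft (corolla S x) ts = Node x ts"
    proof -
      have "graft (corolla S x) (concat (map (\<lambda>t. [t]) ts))
        = Node x (map2 graft (map Leaf (sp_in S x)) (map (\<lambda>t. [t]) ts))"
        unfolding corolla_def using len by (rule graft_Node_concat)
      moreover have "map2 graft (map Leaf (sp_in S x)) (map (\<lambda>t. [t]) ts) = ts"
        using \<open>length (sp_in S x) = length ts\<close> by (intro nth_equalityI) auto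
      ultimately show ?thesis by (simp add: concat_map_singleton)
    qed
    have 2: "composable (Free S) (corolla S x) ts"
      using Node.prems sp_in_colors[of x]
      by (auto simp: composable_def Free_def corolla_def o_def)
    have "map (op_map F) ts = map (tree_ext Q c v) ts"
      using Node by auto
    then show ?case
      using F.comp_map[OF 2] 1 node[of x] Node.prems by (simp add: Free_def del: map_eq_conv)
  qed
  then have "op_map F = op_map (Free_ext S Q c v)"
    using F.op_map_in by (intro extensionalityI[where A = "trees S"])
      (auto simp: Free_ext_def Free_def PiE_def)
  moreover have "col_map F = col_map (Free_ext S Q c v)"
    using F.col_map_in col by (intro extensionalityI[where A = "sp_colors S"])
      (auto simp: Free_ext_def Free_def PiE_def)
  ultimately show ?thesis by simp
qed

end


section \<open>Spliced arrows form an operad\<close>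

lemma juxtapose_simps [simp]:
  "juxtapose C [u] ws = Comp C u (hd ws) # tl ws"
  "us \<noteq> [] \<Longrightarrow> juxtapose C (u # us) ws = u # juxtapose C us ws"
  by (simp_all add: juxtapose_def)

lemma juxtapose_not_Nil [simp]: "juxtapose C us ws \<noteq> []"
  by (simp add: juxtapose_def)

abbreviation gaps :: "('o, 'a) category \<Rightarrow> 'a list \<Rightarrow> ('o \<times> 'o) list" where
  "gaps C ws \<equiv> op_ins (Spliced C) ws"

lemma gaps_simps [simp]:
  "gaps C [w] = []"
  "gaps C (w # w' # ws) = (Cod C w, Dom C w') # gaps C (w' # ws)"
  by (simp_all add: Spliced_def)

lemma composable_Spliced_single [simp]:
  "composable (Spliced C) [w] uss \<longleftrightarrow> w \<in> Arr C \<and> uss = []"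
  by (auto simp: composable_def Spliced_def)

lemma composable_Spliced_Cons:
  "composable (Spliced C) (w # w' # ws) uss \<longleftrightarrow>
     (\<exists>us uss'. uss = us # uss' \<and> w \<in> Arr C \<and> us \<noteq> [] \<and> set us \<subseteq> Arr C \<and>
        Dom C (hd us) = Cod C w \<and> Cod C (last us) = Dom C w' \<and>
        composable (Spliced C) (w' # ws) uss')"
  by (cases uss) (auto simp: composable_def Spliced_def)

context category
begin

lemma juxtapose_in:
  "\<lbrakk>us \<noteq> []; ws \<noteq> []; set us \<subseteq> Arr C; set ws \<subseteq> Arr C; Cod C (last us) = Dom C (hd ws)\<rbrakk>
    \<Longrightarrow> set (juxtapose C us ws) \<subseteq> Arr C"
  by (cases ws; induction us rule: induct_list012) (auto simp: Comp_in)

lemma Dom_juxtapose: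
  "\<lbrakk>us \<noteq> []; ws \<noteq> []; set us \<subseteq> Arr C; set ws \<subseteq> Arr C; Cod C (last us) = Dom C (hd ws)\<rbrakk>
    \<Longrightarrow> Dom C (hd (juxtapose C us ws)) = Dom C (hd us)"
  by (cases ws; induction us rule: induct_list012) (auto simp: Dom_Comp)

lemma Cod_juxtapose:
  "\<lbrakk>us \<noteq> []; ws \<noteq> []; set us \<subseteq> Arr C; set ws \<subseteq> Arr C; Cod C (last us) = Dom C (hd ws)\<rbrakk>
    \<Longrightarrow> Cod C (last (juxtapose C us ws)) = Cod C (last ws)"
  by (cases ws; induction us rule: induct_list012) (auto simp: Cod_Comp)

lemma gaps_juxtapose:
  assumes "us \<noteq> []" "ws \<noteq> []" "set us \<subseteq> Arr C" "set ws \<subseteq> Arr C" "Cod C (last us) = Dom C (hd ws)"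
  shows "gaps C (juxtapose C us ws) = gaps C us @ gaps C ws"
proof -
  obtain w ws' where ws: "ws = w # ws'" using assms(2) by (cases ws) auto
  show ?thesis
    using assms unfolding ws
  proof (induction us rule: induct_list012)
    case (2 u)
    then show ?case by (cases ws') (auto simp: Cod_Comp)
  next
    case (3 u u' us)
    then show ?case by (cases us) (auto simp: Dom_Comp)
  qed auto
qed

lemma juxtapose_assoc:
  assumes "us \<noteq> []" "vs \<noteq> []" "ws \<noteq> []" "set us \<subseteq> Arr C" "set vs \<subseteq> Arr C" "set ws \<subseteq> Arr C"
    "Cod C (last us) = Dom C (hd vs)" "Cod C (last vs) = Dom C (hd ws)"
  shows "juxtapose C (juxtapose C us vs) ws = juxtapose C us (juxtapose C vs ws)"
proof -
  obtain w ws' where ws: "ws = w # ws'" using assms(3) by (cases ws) auto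
  obtain v vs' where vs: "vs = v # vs'" using assms(2) by (cases vs) auto
  show ?thesis
    using assms unfolding ws vs
    by (induction us rule: induct_list012; cases "vs' = []") (auto simp: Comp_assoc)
qed

lemma fill_gaps_types:
  "composable (Spliced C) ws uss \<Longrightarrow>
     fill_gaps C ws uss \<noteq> [] \<and> set (fill_gaps C ws uss) \<subseteq> Arr C \<and>
     Dom C (hd (fill_gaps C ws uss)) = Dom C (hd ws) \<and>
     Cod C (last (fill_gaps C ws uss)) = Cod C (last ws) \<and>
     gaps C (fill_gaps C ws uss) = concat (map (gaps C) uss)"
proof (induction ws arbitrary: uss rule: induct_list012)
  case 1
  then show ?case by (simp add: composable_def Spliced_def)
next
  case (2 w)
  then show ?case by simp
next
  case (3 w w' ws)
  then obtain us uss' where us: "uss = us # uss'" "w \<in> Arr C" "us \<noteq> []" "set us \<subseteq> Arr C"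
    "Dom C (hd us) = Cod C w" "Cod C (last us) = Dom C w'" "composable (Spliced C) (w' # ws) uss'"
    by (auto simp: composable_Spliced_Cons)
  let ?l = "juxtapose C [w] us" and ?r = "fill_gaps C (w' # ws) uss'"
  have l: "set ?l \<subseteq> Arr C" "Dom C (hd ?l) = Dom C w" "Cod C (last ?l) = Dom C w'" "gaps C ?l = gaps C us"
    using us juxtapose_in[of "[w]" us] Dom_juxtapose[of "[w]" us] Cod_juxtapose[of "[w]" us]
      gaps_juxtapose[of "[w]" us] by auto
  have r: "?r \<noteq> []" "set ?r \<subseteq> Arr C" "Dom C (hd ?r) = Dom C w'" "Cod C (last ?r) = Cod C (last (w' # ws))"
    "gaps C ?r = concat (map (gaps C) uss')"
    using "3.IH"(2)[OF us(7)] by auto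
  have "fill_gaps C (w # w' # ws) uss = juxtapose C ?l ?r"
    by (simp add: us(1) del: juxtapose_simps)
  then show ?case
    using l r us(1) juxtapose_in[of ?l ?r] Dom_juxtapose[of ?l ?r] Cod_juxtapose[of ?l ?r]
      gaps_juxtapose[of ?l ?r] by (simp del: juxtapose_simps fill_gaps.simps)
qed

lemma composable_SplicedD:
  "composable (Spliced C) ws uss \<Longrightarrow> ws \<noteq> [] \<and> set ws \<subseteq> Arr C"
  by (simp add: composable_def Spliced_def)

lemma fill_gaps_juxtapose_single:
  assumes "u \<in> Arr C" "composable (Spliced C) ws vss" "Cod C u = Dom C (hd ws)"
  shows "fill_gaps C (juxtapose C [u] ws) vss = juxtapose C [u] (fill_gaps C ws vss)"
proof -
  consider (1) "ws = []" | (2) w where "ws = [w]" | (3) w w' ws' where "ws = w # w' # ws'"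
    by (metis list.exhaust)
  then show ?thesis
  proof cases
    case 1
    then show ?thesis using assms by (simp add: composable_def Spliced_def)
  next
    case (2 w)
    then show ?thesis using assms by simp
  next
    case (3 w w' ws')
    with assms obtain vs vss' where vs: "vss = vs # vss'" "w \<in> Arr C" "vs \<noteq> []" "set vs \<subseteq> Arr C"
      "Dom C (hd vs) = Cod C w" "Cod C (last vs) = Dom C w'" "composable (Spliced C) (w' # ws') vss'"
      by (auto simp: composable_Spliced_Cons)
    let ?l = "juxtapose C [w] vs" and ?r = "fill_gaps C (w' # ws') vss'"
    have l: "set ?l \<subseteq> Arr C" "Dom C (hd ?l) = Dom C w" "Cod C (last ?l) = Dom C w'"
      using vs juxtapose_in[of "[w]" vs] Dom_juxtapose[of "[w]" vs] Cod_juxtapose[of "[w]" vs] by auto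
    have "juxtapose C [u] (juxtapose C ?l ?r) = juxtapose C (juxtapose C [u] ?l) ?r"
      using assms l vs fill_gaps_types[OF vs(7)] 3 by (intro juxtapose_assoc[symmetric]) auto
    also have "juxtapose C [u] ?l = juxtapose C [Comp C u w] vs"
      using assms vs 3 by (cases vs) (auto simp: Comp_assoc)
    finally show ?thesis
      by (simp add: 3 vs(1))
  qed
qed

lemma fill_gaps_juxtapose:
  "\<lbrakk>composable (Spliced C) us vss; composable (Spliced C) ws vss'; Cod C (last us) = Dom C (hd ws)\<rbrakk>
    \<Longrightarrow> fill_gaps C (juxtapose C us ws) (vss @ vss')
      = juxtapose C (fill_gaps C us vss) (fill_gaps C ws vss')"
proof (induction us arbitrary: vss rule: induct_list012)
  case 1
  then show ?case by (simp add: composable_def Spliced_def)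
next
  case (2 u)
  then show ?case using fill_gaps_juxtapose_single[of u ws vss'] by simp
next
  case (3 u u' us)
  then obtain vs vss1 where vs: "vss = vs # vss1" "u \<in> Arr C" "vs \<noteq> []" "set vs \<subseteq> Arr C"
    "Dom C (hd vs) = Cod C u" "Cod C (last vs) = Dom C u'" "composable (Spliced C) (u' # us) vss1"
    by (auto simp: composable_Spliced_Cons)
  let ?l = "juxtapose C [u] vs"
  have l: "set ?l \<subseteq> Arr C" "Dom C (hd ?l) = Dom C u" "Cod C (last ?l) = Dom C u'"
    using vs juxtapose_in[of "[u]" vs] Dom_juxtapose[of "[u]" vs] Cod_juxtapose[of "[u]" vs] by auto
  have "fill_gaps C (juxtapose C (u # u' # us) ws) (vss @ vss')
      = juxtapose C ?l (fill_gaps C (juxtapose C (u' # us) ws) (vss1 @ vss'))"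
    by (simp add: vs(1))
  also have "\<dots> = juxtapose C ?l (juxtapose C (fill_gaps C (u' # us) vss1) (fill_gaps C ws vss'))"
    using "3.IH"(2)[OF vs(7)] "3.prems" by (simp del: juxtapose_simps)
  also have "\<dots> = juxtapose C (juxtapose C ?l (fill_gaps C (u' # us) vss1)) (fill_gaps C ws vss')"
    using l vs fill_gaps_types[OF vs(7)] fill_gaps_types[OF "3.prems"(2)] "3.prems"(3)
    by (intro juxtapose_assoc[symmetric]) auto
  finally show ?case by (simp add: vs(1))
qed

lemma fill_gaps_assoc:
  "\<lbrakk>composable (Spliced C) ws uss; list_all2 (composable (Spliced C)) uss vsss\<rbrakk>
    \<Longrightarrow> fill_gaps C (fill_gaps C ws uss) (concat vsss) = fill_gaps C ws (map2 (fill_gaps C) uss vsss)"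
proof (induction ws arbitrary: uss vsss rule: induct_list012)
  case 1
  then show ?case by (simp add: composable_def Spliced_def)
next
  case (2 w)
  then show ?case by simp
next
  case (3 w w' ws)
  then obtain us uss' where us: "uss = us # uss'" "w \<in> Arr C" "us \<noteq> []" "set us \<subseteq> Arr C"
    "Dom C (hd us) = Cod C w" "Cod C (last us) = Dom C w'" "composable (Spliced C) (w' # ws) uss'"
    by (auto simp: composable_Spliced_Cons)
  with "3.prems" obtain vss vsss' where vs: "vsss = vss # vsss'" "composable (Spliced C) us vss"
    "list_all2 (composable (Spliced C)) uss' vsss'"
    by (auto simp: list_all2_Cons1)
  let ?l = "juxtapose C [w] us" and ?r = "fill_gaps C (w' # ws) uss'"
  have l: "set ?l \<subseteq> Arr C" "Cod C (last ?l) = Dom C w'" "gaps C ?l = gaps C us"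
    using us juxtapose_in[of "[w]" us] Cod_juxtapose[of "[w]" us] gaps_juxtapose[of "[w]" us] by auto
  have r: "?r \<noteq> []" "set ?r \<subseteq> Arr C" "Dom C (hd ?r) = Dom C w'"
    "gaps C ?r = concat (map (gaps C) uss')"
    using fill_gaps_types[OF us(7)] by auto
  have cl: "composable (Spliced C) ?l vss"
    using vs(2) l by (auto simp: composable_def) (simp add: Spliced_def)
  have "map (op_out (Spliced C)) (concat vsss') = concat (map (gaps C) uss') \<and>
        set (concat vsss') \<subseteq> Ops (Spliced C)"
    using vs(3) by (induction rule: list_all2_induct) (auto simp: composable_def)
  then have cr: "composable (Spliced C) ?r (concat vsss')"
    using r by (auto simp: composable_def) (auto simp: Spliced_def)
  have "fill_gaps C (fill_gaps C (w # w' # ws) uss) (concat vsss)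
      = fill_gaps C (juxtapose C ?l ?r) (vss @ concat vsss')"
    by (simp add: us(1) vs(1) del: juxtapose_simps)
  also have "\<dots> = juxtapose C (fill_gaps C ?l vss) (fill_gaps C ?r (concat vsss'))"
    using cl cr l r by (intro fill_gaps_juxtapose) simp_all
  also have "fill_gaps C ?l vss = juxtapose C [w] (fill_gaps C us vss)"
    using us vs(2) by (intro fill_gaps_juxtapose_single) auto
  also have "fill_gaps C ?r (concat vsss') = fill_gaps C (w' # ws) (map2 (fill_gaps C) uss' vsss')"
    using "3.IH"(2)[OF us(7) vs(3)] .
  finally show ?case
    by (simp add: us(1) vs(1))
qed

lemma fill_gaps_Ident:
  "\<lbrakk>ws \<noteq> []; set ws \<subseteq> Arr C\<rbrakk> \<Longrightarrow> fill_gaps C ws (map (op_id (Spliced C)) (gaps C ws)) = ws"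
proof (induction ws rule: induct_list012)
  case (3 w w' ws)
  then have "op_id (Spliced C) (Cod C w, Dom C w') = [Ident C (Cod C w), Ident C (Dom C w')]"
    by (simp add: Spliced_def)
  with 3 show ?case by (simp add: Ident_Comp Comp_Ident)
qed auto

lemma Ident_fill_gaps:
  assumes "ws \<noteq> []" "set ws \<subseteq> Arr C"
  shows "fill_gaps C [Ident C (Dom C (hd ws)), Ident C (Cod C (last ws))] [ws] = ws"
proof -
  have "juxtapose C ws [Ident C (Cod C (last ws))] = ws"
    using assms by (induction ws rule: induct_list012) (auto simp: Comp_Ident)
  then show ?thesis
    using assms by (cases ws) (auto simp: Ident_Comp)
qed

lemma operad_Spliced: "operad (Spliced C)"
proof
  fix ws uss
  assume *: "composable (Spliced C) ws uss"
  have comp: "op_comp (Spliced C) = fill_gaps C"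
    by (simp add: Spliced_def)
  show "op_comp (Spliced C) ws uss \<in> Ops (Spliced C)"
    "op_out (Spliced C) (op_comp (Spliced C) ws uss) = op_out (Spliced C) ws"
    "gaps C (op_comp (Spliced C) ws uss) = concat (map (gaps C) uss)"
    unfolding comp using fill_gaps_types[OF *] by (simp_all add: Spliced_def)
  fix vsss
  assume "list_all2 (composable (Spliced C)) uss vsss"
  with * show "op_comp (Spliced C) (op_comp (Spliced C) ws uss) (concat vsss)
      = op_comp (Spliced C) ws (map2 (op_comp (Spliced C)) uss vsss)"
    unfolding comp by (rule fill_gaps_assoc)
next
  fix ws assume ws: "ws \<in> Ops (Spliced C)"
  then have ws': "ws \<noteq> []" "set ws \<subseteq> Arr C"
    by (simp_all add: Spliced_def)
  show "op_comp (Spliced C) ws (map (op_id (Spliced C)) (gaps C ws)) = ws"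
    using fill_gaps_Ident[OF ws'] by (simp add: Spliced_def)
  show "op_comp (Spliced C) (op_id (Spliced C) (op_out (Spliced C) ws)) [ws] = ws"
    using Ident_fill_gaps[OF ws'] by (simp add: Spliced_def)
  show "op_out (Spliced C) ws \<in> Colors (Spliced C)"
    using ws' by (auto simp: Spliced_def Dom_in Cod_in subset_iff)
  show "set (gaps C ws) \<subseteq> Colors (Spliced C)"
  proof -
    have "set (map (Cod C) (butlast ws)) \<subseteq> Obj C" "set (map (Dom C) (tl ws)) \<subseteq> Obj C"
      using ws' by (auto simp: Cod_in Dom_in subset_iff dest: in_set_butlastD list.set_sel(2))
    then show ?thesis
      by (auto simp: Spliced_def simp del: set_map dest: set_zip_leftD set_zip_rightD)
  qed
qed (auto simp: Spliced_def Ident_in Dom_Ident Cod_Ident)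

end


section \<open>The universal grammar is a grammar\<close>

locale graph =
  fixes g :: "('o, 'e) graph"
  assumes src_in: "e \<in> edges g \<Longrightarrow> src g e \<in> verts g"
    and tgt_in: "e \<in> edges g \<Longrightarrow> tgt g e \<in> verts g"
begin

lemma path_verts: "path g A es B \<Longrightarrow> A \<in> verts g \<and> B \<in> verts g"
  by (induction es arbitrary: A) auto

lemma path_append: "\<lbrakk>path g A es B; path g B es' B'\<rbrakk> \<Longrightarrow> path g A (es @ es') B'"
  by (induction es arbitrary: A) auto

lemma category_Free_cat: "category (Free_cat g)"
  by standard (auto simp: Free_cat_def path_append dest: path_verts)

lemma finitely_generated_Free_cat:
  assumes "finite (verts g)" "finite (edges g)"
  shows "finitely_generated (Free_cat g)"
proof -
  let ?X = "gen_arrow g ` edges g"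
  have "(A, es, B) \<in> generated_arrows (Free_cat g) ?X" if "path g A es B" for A es B
    using that
  proof (induction es arbitrary: A)
    case Nil
    then show ?case
      using generated_arrows.ident[of A "Free_cat g" ?X] by (auto simp: Free_cat_def)
  next
    case (Cons e es)
    then have "gen_arrow g e \<in> generated_arrows (Free_cat g) ?X"
      "(tgt g e, es, B) \<in> generated_arrows (Free_cat g) ?X"
      by (auto intro: generated_arrows.gen)
    from generated_arrows.comp[OF this] Cons.prems show ?case
      by (auto simp: Free_cat_def gen_arrow_def)
  qed
  moreover have "?X \<subseteq> Arr (Free_cat g)"
    by (auto simp: Free_cat_def gen_arrow_def src_in tgt_in)
  ultimately show ?thesis
    unfolding finitely_generated_def using assms
    by (intro conjI exI[of _ ?X]) (auto simp: Free_cat_def)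
qed

end

context species
begin

lemma graph_contour_graph: "graph (contour_graph S)"
proof
  fix e assume "e \<in> edges (contour_graph S)"
  then obtain x i where e: "e = (x, i)" "x \<in> sp_nodes S" "i \<le> length (sp_in S x)"
    by (auto simp: contour_graph_def)
  moreover have "sp_in S x ! j \<in> sp_colors S" if "j < length (sp_in S x)" for j
    using sp_in_colors[OF e(2)] that by auto
  ultimately show "src (contour_graph S) e \<in> verts (contour_graph S)"
    "tgt (contour_graph S) e \<in> verts (contour_graph S)"
    by (auto simp: contour_graph_def sp_out_colors)
qed

lemma category_contour_cat: "category (contour_cat S)"
  unfolding contour_cat_def by (intro graph.category_Free_cat graph_contour_graph)

lemma free_assignment_contour:
  "free_assignment S (Spliced (contour_cat S)) contour_colors (contour_node S)"
proof -
  interpret operad "Spliced (contour_cat S)"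
    by (intro category.operad_Spliced category_contour_cat)
  interpret graph "contour_graph S"
    by (rule graph_contour_graph)
  show ?thesis
  proof
    fix x assume x: "x \<in> sp_nodes S"
    let ?n = "length (sp_in S x)"
    have "path (contour_graph S) (src (contour_graph S) (x, i)) [(x, i)] (tgt (contour_graph S) (x, i))"
      if "i \<le> ?n" for i
      using src_in[of "(x, i)"] tgt_in[of "(x, i)"] that x by (simp add: contour_graph_def)
    then show "contour_node S x \<in> Ops (Spliced (contour_cat S))"
      by (auto simp: Spliced_def contour_node_def contour_cat_def Free_cat_def gen_arrow_def
          simp del: path.simps)
    show "op_ins (Spliced (contour_cat S)) (contour_node S x) = map contour_colors (sp_in S x)"
      by (intro nth_equalityI)
        (auto simp: Spliced_def contour_node_def contour_cat_def Free_cat_def gen_arrow_def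
          contour_graph_def contour_colors_def nth_tl nth_butlast simp del: upt_Suc)
    show "op_out (Spliced (contour_cat S)) (contour_node S x) = contour_colors (sp_out S x)"
      by (auto simp: Spliced_def contour_node_def contour_cat_def Free_cat_def gen_arrow_def
          contour_graph_def contour_colors_def hd_map last_map simp del: upt_Suc)
  qed (auto simp: Spliced_def contour_cat_def Free_cat_def contour_graph_def contour_colors_def)
qed

lemma contour_proj_corolla:
  "x \<in> sp_nodes S \<Longrightarrow> op_map (contour_proj S) (corolla S x) = contour_node S x"
  unfolding contour_proj_def
  by (rule free_assignment.Free_ext_corolla[OF free_assignment_contour])

end

lemma cf_grammar_Univ:
  assumes "finite_species S" "s \<in> sp_colors S"
  shows "cf_grammar (Univ S s)"
proof -
  interpret finite_species S by (rule assms)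
  have "edges (contour_graph S) = Sigma (sp_nodes S) (\<lambda>x. {..length (sp_in S x)})"
    by (auto simp: contour_graph_def)
  then have fin: "finite (verts (contour_graph S))" "finite (edges (contour_graph S))"
    using finite_colors finite_nodes by (auto simp: contour_graph_def)
  have "finitely_generated (contour_cat S)"
    unfolding contour_cat_def
    by (intro graph.finitely_generated_Free_cat graph_contour_graph fin)
  moreover have "operad_functor (Free S) (Spliced (contour_cat S)) (contour_proj S)"
    unfolding contour_proj_def
    by (rule free_assignment.operad_functor_Free_ext[OF free_assignment_contour])
  ultimately show ?thesis
    by (simp add: cf_grammar_def Univ_def category_contour_cat assms)
qed

end

(*
  Both p and W[q] o p_S are functors out of a free operad, so they agree as soon as they agree on
  colors and corollas.  Since p_S sends x to the sequence of generators (x,0), ..., (x,n), this says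
  that q sends R^u, R^d to the two components of p(R) and (x,i) to the i-th arrow of p(x); the
  contour category being free, there is exactly one such q.
*)
theory Submission
  imports Defs
begin

section \<open>Functors of operads\<close>

lemma operad_functor_comp:
  assumes "operad_functor P Q F" "operad_functor Q R G"
  shows "operad_functor P R (operad_functor_comp P G F)"
proof -
  interpret F: operad_functor P Q F by (rule assms(1))
  interpret G: operad_functor Q R G by (rule assms(2))
  have F_in: "op_map F f \<in> Ops Q" if "f \<in> Ops P" for f
    using F.op_map_in that by auto
  have F_col: "col_map F A \<in> Colors Q" if "A \<in> Colors P" for A
    using F.col_map_in that by auto
  show ?thesis
  proof
    show "col_map (operad_functor_comp P G F) \<in> Colors P \<rightarrow>\<^sub>E Colors R"
      "op_map (operad_functor_comp P G F) \<in> Ops P \<rightarrow>\<^sub>E Ops R"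
      using F.col_map_in G.col_map_in F.op_map_in G.op_map_in
      by (auto simp: operad_functor_comp_def compose_def)
  next
    fix f assume f: "f \<in> Ops P"
    then show "op_out R (op_map (operad_functor_comp P G F) f)
        = col_map (operad_functor_comp P G F) (op_out P f)"
      by (simp add: operad_functor_comp_def compose_eq F_in G.output_map F.output_map F.dom.output_in)
    \<comment> \<open>\<open>compose\<close> is \<open>undefined\<close> outside
      \<open>Colors P\<close>; the inputs of \<open>f\<close> are colors, so it may be unfolded on
      each of them.\<close>
    have "map (compose (Colors P) (col_map G) (col_map F)) (op_ins P f)
        = map (col_map G) (map (col_map F) (op_ins P f))"
      using F.dom.inputs_in[OF f] by (auto simp: compose_eq)
    with f show "op_ins R (op_map (operad_functor_comp P G F) f)
        = map (col_map (operad_functor_comp P G F)) (op_ins P f)"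
      by (simp add: operad_functor_comp_def compose_eq F_in G.inputs_map F.inputs_map
          del: map_map map_eq_conv)
  next
    fix A assume "A \<in> Colors P"
    then show "op_map (operad_functor_comp P G F) (op_id P A)
        = op_id R (col_map (operad_functor_comp P G F) A)"
      by (simp add: operad_functor_comp_def compose_eq F.dom.id_in F.id_map G.id_map F_col)
  next
    fix f gs assume c: "composable P f gs"
    then have in_P: "f \<in> Ops P" "set gs \<subseteq> Ops P" "map (op_out P) gs = op_ins P f"
      by (auto simp: composable_def)
    \<comment> \<open>Since \<open>F\<close> preserves inputs and outputs, colors that match in
      \<open>P\<close> still match in \<open>Q\<close>, as \<open>G.comp_map\<close>
      requires.\<close>
    have "map (op_out Q) (map (op_map F) gs) = map (col_map F) (map (op_out P) gs)"
      using in_P(2) by (auto simp: F.output_map)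
    then have "composable Q (op_map F f) (map (op_map F) gs)"
      unfolding composable_def using in_P by (auto simp: F_in F.inputs_map simp del: map_map)
    moreover have "map (compose (Ops P) (op_map G) (op_map F)) gs = map (op_map G) (map (op_map F) gs)"
      using in_P(2) by (auto simp: compose_eq)
    ultimately show "op_map (operad_functor_comp P G F) (op_comp P f gs)
        = op_comp R (op_map (operad_functor_comp P G F) f) (map (op_map (operad_functor_comp P G F)) gs)"
      using in_P(1) F.dom.comp_in[OF c]
      by (simp add: operad_functor_comp_def compose_eq F.comp_map[OF c] G.comp_map
          del: map_map map_eq_conv)
  qed
qed

section \<open>Equality of functors out of a free operad\<close>

context species
begin

lemma corolla_in_Free:
  assumes "x \<in> sp_nodes S"
  shows "corolla S x \<in> Ops (Free S)" "op_ins (Free S) (corolla S x) = sp_in S x"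
    "op_out (Free S) (corolla S x) = sp_out S x"
  using assms sp_in_colors[OF assms] by (auto simp: Free_def corolla_def o_def)

text \<open>The values of \<open>F'\<close> on colors and corollas form a well-typed assignment, and
  both functors extend it; such an extension is unique.\<close>

lemma operad_functor_eqI:
  assumes F: "operad_functor (Free S) Q F" and F': "operad_functor (Free S) Q F'"
    and col: "\<And>R. R \<in> sp_colors S \<Longrightarrow> col_map F R = col_map F' R"
    and node: "\<And>x. x \<in> sp_nodes S \<Longrightarrow> op_map F (corolla S x) = op_map F' (corolla S x)"
  shows "F = F'"
proof -
  interpret F': operad_functor "Free S" Q F' by (rule F')
  interpret free_assignment S Q "col_map F'" "\<lambda>x. op_map F' (corolla S x)"
  proof
    fix x assume x: "x \<in> sp_nodes S"
    show "op_map F' (corolla S x) \<in> Ops Q"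
      using F'.op_map_in corolla_in_Free[OF x] by auto
    show "op_ins Q (op_map F' (corolla S x)) = map (col_map F') (sp_in S x)"
      "op_out Q (op_map F' (corolla S x)) = col_map F' (sp_out S x)"
      using corolla_in_Free[OF x] by (simp_all add: F'.inputs_map F'.output_map)
  qed (use F'.col_map_in in \<open>auto simp: Free_def\<close>)
  have "F = Free_ext S Q (col_map F') (\<lambda>x. op_map F' (corolla S x))"
    by (intro Free_ext_unique F col node)
  also have "\<dots> = F'"
    by (intro Free_ext_unique[symmetric] F' refl)
  finally show ?thesis .
qed

end

section \<open>The functor of operads W[F]\<close>

context cat_functor
begin

lemma arr_map_Arr: "f \<in> Arr C \<Longrightarrow> arr_map F f \<in> Arr D"
  using arr_map_in by auto

text \<open>The only new arrow is the joint \<open>Comp C (last us) (hd ws)\<close>, whose factors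
  are composable, so \<open>F\<close> preserves it.\<close>

lemma map_juxtapose:
  assumes "us \<noteq> []" "ws \<noteq> []" "set us \<subseteq> Arr C" "set ws \<subseteq> Arr C" "Cod C (last us) = Dom C (hd ws)"
  shows "map (arr_map F) (juxtapose C us ws) = juxtapose D (map (arr_map F) us) (map (arr_map F) ws)"
proof -
  have "last us \<in> Arr C" "hd ws \<in> Arr C"
    using assms by auto
  with assms show ?thesis
    by (simp add: juxtapose_def Comp_map map_butlast last_map hd_map map_tl)
qed

text \<open>Filling the first gap amounts to two juxtapositions, so induction along
  \<open>ws\<close> reduces the claim to \<open>map_juxtapose\<close>.\<close>

lemma map_fill_gaps:
  "composable (Spliced C) ws uss \<Longrightarrow>
    map (arr_map F) (fill_gaps C ws uss) = fill_gaps D (map (arr_map F) ws) (map (map (arr_map F)) uss)"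
proof (induction ws arbitrary: uss rule: induct_list012)
  case (3 w w' ws)
  then obtain us uss' where us: "uss = us # uss'" "w \<in> Arr C" "us \<noteq> []" "set us \<subseteq> Arr C"
    "Dom C (hd us) = Cod C w" "Cod C (last us) = Dom C w'" "composable (Spliced C) (w' # ws) uss'"
    by (auto simp: composable_Spliced_Cons)
  let ?l = "juxtapose C [w] us" and ?r = "fill_gaps C (w' # ws) uss'"
  have "set ?l \<subseteq> Arr C" "Cod C (last ?l) = Dom C w'"
    using us dom.juxtapose_in[of "[w]" us] dom.Cod_juxtapose[of "[w]" us] by auto
  then have "map (arr_map F) (juxtapose C ?l ?r) = juxtapose D (map (arr_map F) ?l) (map (arr_map F) ?r)"
    using dom.fill_gaps_types[OF us(7)] by (intro map_juxtapose) auto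
  also have "map (arr_map F) ?l = juxtapose D [arr_map F w] (map (arr_map F) us)"
    using us map_juxtapose[of "[w]" us] by auto
  also have "map (arr_map F) ?r
      = fill_gaps D (map (arr_map F) (w' # ws)) (map (map (arr_map F)) uss')"
    by (rule "3.IH"(2)[OF us(7)])
  finally show ?case
    by (simp add: us(1) del: juxtapose_simps)
qed auto

lemma operad_functor_Spliced_map: "operad_functor (Spliced C) (Spliced D) (Spliced_map C F)"
proof -
  interpret P: operad "Spliced C" by (rule dom.operad_Spliced)
  interpret Q: operad "Spliced D" by (rule cod.operad_Spliced)
  have obj: "obj_map F A \<in> Obj D" if "A \<in> Obj C" for A
    using obj_map_in that by auto
  show ?thesis
  proof
    show "col_map (Spliced_map C F) \<in> Colors (Spliced C) \<rightarrow>\<^sub>E Colors (Spliced D)"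
      using obj by (auto simp: Spliced_map_def Spliced_def)
    show "op_map (Spliced_map C F) \<in> Ops (Spliced C) \<rightarrow>\<^sub>E Ops (Spliced D)"
      by (auto simp: Spliced_map_def Spliced_def subset_iff intro!: arr_map_Arr)
  next
    fix ws assume ws: "ws \<in> Ops (Spliced C)"
    then have ws': "ws \<noteq> []" "set ws \<subseteq> Arr C" "hd ws \<in> Arr C" "last ws \<in> Arr C"
      by (auto simp: Spliced_def)
    \<comment> \<open>The colors of the gaps lie in \<open>Colors (Spliced C)\<close>, so the
      restriction in \<open>Spliced_map\<close> does not change their images.\<close>
    have map_eq: "map (restrict (map_prod (obj_map F) (obj_map F)) (Colors (Spliced C))) (gaps C ws)
        = map (map_prod (obj_map F) (obj_map F)) (gaps C ws)"
      using P.inputs_in[OF ws] by auto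
    have "gaps D (map (arr_map F) ws) = map (map_prod (obj_map F) (obj_map F)) (gaps C ws)"
      using ws'(2)
      by (induction ws rule: induct_list012) (auto simp: Dom_map Cod_map, simp add: Spliced_def)
    with ws map_eq show "gaps D (op_map (Spliced_map C F) ws)
        = map (col_map (Spliced_map C F)) (gaps C ws)"
      by (simp add: Spliced_map_def)
    show "op_out (Spliced D) (op_map (Spliced_map C F) ws)
        = col_map (Spliced_map C F) (op_out (Spliced C) ws)"
      using ws' by (simp add: Spliced_map_def Spliced_def hd_map last_map Dom_map Cod_map
          dom.Dom_in dom.Cod_in)
  next
    fix R assume "R \<in> Colors (Spliced C)"
    then show "op_map (Spliced_map C F) (op_id (Spliced C) R)
        = op_id (Spliced D) (col_map (Spliced_map C F) R)"
      by (auto simp: Spliced_map_def Spliced_def Ident_map dom.Ident_in)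
  next
    fix ws uss assume c: "composable (Spliced C) ws uss"
    then have map_uss: "map (op_map (Spliced_map C F)) uss = map (map (arr_map F)) uss"
      by (auto simp: Spliced_map_def composable_def)
    have ws: "ws \<in> Ops (Spliced C)"
      using c by (simp add: composable_def)
    show "op_map (Spliced_map C F) (op_comp (Spliced C) ws uss)
        = op_comp (Spliced D) (op_map (Spliced_map C F) ws) (map (op_map (Spliced_map C F)) uss)"
      unfolding map_uss using P.comp_in[OF c] map_fill_gaps[OF c] ws
      by (simp add: Spliced_map_def) (simp add: Spliced_def)
  qed
qed

end


section \<open>The universal property of free categories\<close>

text \<open>A graph morphism from \<open>g\<close> to the underlying graph of \<open>D\<close>, the
  data from which a functor on the free category is built.\<close>

locale graph_assignment = graph g + category D
  for g :: "('v, 'e) graph" and D :: "('p, 'b) category" +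
  fixes ov :: "'v \<Rightarrow> 'p" and ae :: "'e \<Rightarrow> 'b"
  assumes ov_in: "A \<in> verts g \<Longrightarrow> ov A \<in> Obj D"
    and ae_in: "e \<in> edges g \<Longrightarrow> ae e \<in> Arr D"
    and Dom_ae: "e \<in> edges g \<Longrightarrow> Dom D (ae e) = ov (src g e)"
    and Cod_ae: "e \<in> edges g \<Longrightarrow> Cod D (ae e) = ov (tgt g e)"
begin

text \<open>The composite in \<open>D\<close> of the images of the edges. Folding from the right
  follows the recursion of \<open>path\<close>; the final identity is the value on an empty
  path.\<close>

definition path_ext :: "'v \<times> 'e list \<times> 'v \<Rightarrow> 'b" where
  "path_ext = (\<lambda>(A, es, B). foldr (\<lambda>e. Comp D (ae e)) es (Ident D (ov B)))"

lemma path_ext_Nil [simp]: "path_ext (A, [], B) = Ident D (ov B)"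
  by (simp add: path_ext_def)

text \<open>The value depends only on the edges and the target, which leaves \<open>A'\<close> free;
  it is later taken to be \<open>tgt g e\<close>, so that the remaining triple is again a
  path.\<close>

lemma path_ext_Cons: "path_ext (A, e # es, B) = Comp D (ae e) (path_ext (A', es, B))"
  by (simp add: path_ext_def)

lemma path_ext_types:
  "path g A es B \<Longrightarrow> path_ext (A, es, B) \<in> Arr D \<and> Dom D (path_ext (A, es, B)) = ov A \<and>
    Cod D (path_ext (A, es, B)) = ov B"
proof (induction es arbitrary: A)
  case Nil
  then show ?case by (auto simp: Ident_in Dom_Ident Cod_Ident ov_in)
next
  case (Cons e es)
  then show ?case
    by (auto simp: path_ext_Cons[where A' = "tgt g e"] Comp_in Dom_Comp Cod_Comp ae_in Dom_ae Cod_ae)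
qed

text \<open>Induction on the first path: the left identity law gives the empty path, associativity
  the step.\<close>

lemma path_ext_append:
  "\<lbrakk>path g A es B; path g B es' B'\<rbrakk>
    \<Longrightarrow> path_ext (A, es @ es', B') = Comp D (path_ext (A, es, B)) (path_ext (B, es', B'))"
proof (induction es arbitrary: A)
  case Nil
  then show ?case
    using path_ext_types[of A es' B'] Ident_Comp[of "path_ext (A, es', B')"] by auto
next
  case (Cons e es)
  then show ?case
    using path_ext_types[of "tgt g e" es B] path_ext_types[of B es' B']
    by (auto simp: path_ext_Cons[where A' = "tgt g e"] Comp_assoc ae_in Cod_ae)
qed

definition path_functor :: "('v, 'v \<times> 'e list \<times> 'v, 'p, 'b) cat_functor" where
  "path_functor = \<lparr>obj_map = restrict ov (Obj (Free_cat g)), arr_map = restrict path_ext (Arr (Free_cat g))\<rparr>"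

lemma cat_functor_path_functor: "cat_functor (Free_cat g) D path_functor"
proof -
  interpret C: category "Free_cat g" by (rule category_Free_cat)
  show ?thesis
  proof
    fix f h assume fh: "f \<in> Arr (Free_cat g)" "h \<in> Arr (Free_cat g)"
      "Cod (Free_cat g) f = Dom (Free_cat g) h"
    from C.Comp_in[OF this] fh show "arr_map path_functor (Comp (Free_cat g) f h)
        = Comp D (arr_map path_functor f) (arr_map path_functor h)"
      by (auto simp: path_functor_def Free_cat_def path_ext_append)
  qed (auto simp: path_functor_def Free_cat_def path_ext_types ov_in dest: path_verts)
qed

text \<open>The path of one edge goes to \<open>ae e\<close> followed by an identity, which the
  right identity law removes.\<close>

lemma path_functor_gen: "e \<in> edges g \<Longrightarrow> arr_map path_functor (gen_arrow g e) = ae e"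
  using Comp_Ident[OF ae_in]
  by (simp add: path_functor_def Free_cat_def gen_arrow_def path_ext_Cons[where A' = "tgt g e"] src_in tgt_in Cod_ae)

end

text \<open>Every path is an identity or a generator followed by a shorter path, so induction
  determines both functors on arrows; extensionality gives equality.\<close>

lemma (in graph) cat_functor_Free_cat_eqI:
  assumes F: "cat_functor (Free_cat g) D F" and F': "cat_functor (Free_cat g) D F'"
    and obj: "\<And>A. A \<in> verts g \<Longrightarrow> obj_map F A = obj_map F' A"
    and gen: "\<And>e. e \<in> edges g \<Longrightarrow> arr_map F (gen_arrow g e) = arr_map F' (gen_arrow g e)"
  shows "F = F'"
proof -
  interpret F: cat_functor "Free_cat g" D F by (rule F)
  interpret F': cat_functor "Free_cat g" D F' by (rule F')
  have "arr_map F (A, es, B) = arr_map F' (A, es, B)" if "path g A es B" for A es B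
    using that
  proof (induction es arbitrary: A)
    case Nil
    then show ?case
      using F.Ident_map[of A] F'.Ident_map[of A] obj by (auto simp: Free_cat_def)
  next
    case (Cons e es)
    then have e: "gen_arrow g e \<in> Arr (Free_cat g)" "(tgt g e, es, B) \<in> Arr (Free_cat g)"
      "Cod (Free_cat g) (gen_arrow g e) = Dom (Free_cat g) (tgt g e, es, B)"
      and eq: "(A, e # es, B) = Comp (Free_cat g) (gen_arrow g e) (tgt g e, es, B)"
      by (auto simp: Free_cat_def gen_arrow_def tgt_in)
    show ?case
      unfolding eq F.Comp_map[OF e] F'.Comp_map[OF e] using Cons gen by simp
  qed
  then have "arr_map F = arr_map F'"
    using F.arr_map_in F'.arr_map_in by (intro extensionalityI[where A = "Arr (Free_cat g)"])
      (auto simp: Free_cat_def PiE_def)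
  moreover have "obj_map F = obj_map F'"
    using F.obj_map_in F'.obj_map_in obj by (intro extensionalityI[where A = "Obj (Free_cat g)"])
      (auto simp: Free_cat_def PiE_def)
  ultimately show ?thesis by simp
qed


section \<open>The universal grammar\<close>

context species
begin

lemma operad_functor_contour_proj: "operad_functor (Free S) (Spliced (contour_cat S)) (contour_proj S)"
  unfolding contour_proj_def
  by (rule free_assignment.operad_functor_Free_ext[OF free_assignment_contour])

text \<open>Both sides of the equation are functors on \<open>Free S\<close>, so
  \<open>operad_functor_eqI\<close> leaves only colors and corollas, where the composite can be
  computed.\<close>

lemma factorization_iff:
  assumes p: "operad_functor (Free S) (Spliced D) p" and q: "cat_functor (contour_cat S) D q"
  shows "p = operad_functor_comp (Free S) (Spliced_map (contour_cat S) q) (contour_proj S) \<longleftrightarrow>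
    (\<forall>R \<in> sp_colors S. col_map p R = (obj_map q (Up R), obj_map q (Down R))) \<and>
    (\<forall>x \<in> sp_nodes S. op_map p (corolla S x) = map (arr_map q) (contour_node S x))"
    (is "p = ?p' \<longleftrightarrow> _")
proof -
  interpret q: cat_functor "contour_cat S" D q by (rule q)
  have p': "operad_functor (Free S) (Spliced D) ?p'"
    by (rule operad_functor_comp[OF operad_functor_contour_proj q.operad_functor_Spliced_map])
  have col: "col_map ?p' R = (obj_map q (Up R), obj_map q (Down R))" if "R \<in> sp_colors S" for R
    using that by (simp add: operad_functor_comp_def compose_eq Spliced_map_def contour_proj_def
        Free_ext_def Free_def Spliced_def contour_colors_def contour_cat_def Free_cat_def contour_graph_def)
  \<comment> \<open>Membership of \<open>contour_node S x\<close> in the spliced operations ensures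
    that \<open>Spliced_map\<close> acts on it by \<open>map (arr_map q)\<close>.\<close>
  have node: "op_map ?p' (corolla S x) = map (arr_map q) (contour_node S x)" if "x \<in> sp_nodes S" for x
    using that free_assignment.v_in[OF free_assignment_contour that] corolla_in_Free[OF that]
    by (simp add: operad_functor_comp_def compose_eq Spliced_map_def contour_proj_corolla)
  show ?thesis
    using operad_functor_eqI[OF p p'] col node by metis
qed

text \<open>The equation for \<open>q\<close> amounts to prescribing \<open>q\<close> on the
  vertices and edges of the contour graph, and such a prescription extends uniquely to the free
  category.\<close>

lemma ex1_factorization:
  fixes D :: "('o, 'a) category"
  assumes p: "operad_functor (Free S) (Spliced D) p" and D: "category D"
  shows "\<exists>!q. cat_functor (contour_cat S) D q \<and>
    p = operad_functor_comp (Free S) (Spliced_map (contour_cat S) q) (contour_proj S)"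
proof -
  interpret p: operad_functor "Free S" "Spliced D" p by (rule p)
  interpret D: category D by (rule D)
  interpret contour: graph "contour_graph S" by (rule graph_contour_graph)
  \<comment> \<open>The values forced on \<open>q\<close>: the two components of p(R) on
    \<open>Up R\<close> and \<open>Down R\<close>, and the arrow at index \<open>i\<close> of p(x)
    on the edge \<open>(x, i)\<close>.\<close>
  define ov where "ov A = (case A of Up R \<Rightarrow> fst (col_map p R) | Down R \<Rightarrow> snd (col_map p R))" for A
  define ae where "ae = (\<lambda>(x, i). op_map p (corolla S x) ! i)"
  have node: "op_map p (corolla S x) \<in> Ops (Spliced D)"
    "gaps D (op_map p (corolla S x)) = map (col_map p) (sp_in S x)"
    "op_out (Spliced D) (op_map p (corolla S x)) = col_map p (sp_out S x)"
    if "x \<in> sp_nodes S" for x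
    using that p.op_map_in corolla_in_Free[OF that] p.inputs_map p.output_map by auto
  \<comment> \<open>A spliced arrow has one more arrow than gaps, so every index from 0 to the arity
    of \<open>x\<close> is valid.\<close>
  have len: "length (op_map p (corolla S x)) = Suc (length (sp_in S x))" if "x \<in> sp_nodes S" for x
    using node(1)[OF that] arg_cong[OF node(2)[OF that], of length]
    by (auto simp: Spliced_def Suc_pred' simp flip: length_greater_0_conv)
  have col: "col_map p R \<in> Obj D \<times> Obj D" if "R \<in> sp_colors S" for R
    using p.col_map_in that by (auto simp: Free_def Spliced_def)
  interpret graph_assignment "contour_graph S" D ov ae
  proof
    fix A assume "A \<in> verts (contour_graph S)"
    then show "ov A \<in> Obj D"
      using col by (auto simp: ov_def contour_graph_def mem_Times_iff)
  next
    fix e assume "e \<in> edges (contour_graph S)"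
    then obtain x i where e: "e = (x, i)" "x \<in> sp_nodes S" "i \<le> length (sp_in S x)"
      by (auto simp: contour_graph_def)
    define ws where "ws = op_map p (corolla S x)"
    have ws: "ws \<noteq> []" "set ws \<subseteq> Arr D" "length ws = Suc (length (sp_in S x))"
      "zip (map (Cod D) (butlast ws)) (map (Dom D) (tl ws)) = map (col_map p) (sp_in S x)"
      "(Dom D (hd ws), Cod D (last ws)) = col_map p (sp_out S x)"
      using node[OF e(2)] len[OF e(2)] by (auto simp: ws_def Spliced_def)
    \<comment> \<open>The gap at position \<open>j\<close> lies between the arrows at
      \<open>j\<close> and \<open>Suc j\<close>.\<close>
    have gap: "(Cod D (ws ! j), Dom D (ws ! Suc j)) = col_map p (sp_in S x ! j)"
      if "j < length (sp_in S x)" for j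
      using arg_cong[OF ws(4), of "\<lambda>l. l ! j"] ws(3) that by (simp add: nth_butlast nth_tl)
    show "ae e \<in> Arr D"
      using e ws by (auto simp: ae_def simp flip: ws_def)
    show "Dom D (ae e) = ov (src (contour_graph S) e)"
    \<comment> \<open>The first arrow starts at the first component of the output color, each later
      one at the second component of the gap before it.\<close>
    proof (cases i)
      case 0
      then show ?thesis
        using e ws by (auto simp: ae_def ov_def contour_graph_def hd_conv_nth simp flip: ws_def
            dest: arg_cong[of _ _ fst])
    next
      case (Suc j)
      then show ?thesis
        using e gap[of j] by (auto simp: ae_def ov_def contour_graph_def simp flip: ws_def
            dest: arg_cong[of _ _ snd])
    qed
    show "Cod D (ae e) = ov (tgt (contour_graph S) e)"
    \<comment> \<open>Dually, the last arrow ends at the second component of the output color, each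
      earlier one at the first component of the gap after it.\<close>
    proof (cases "i = length (sp_in S x)")
      case True
      then show ?thesis
        using e ws by (auto simp: ae_def ov_def contour_graph_def last_conv_nth simp flip: ws_def
            dest: arg_cong[of _ _ snd])
    next
      case False
      then show ?thesis
        using e gap[of i] by (auto simp: ae_def ov_def contour_graph_def simp flip: ws_def
            dest: arg_cong[of _ _ fst])
    qed
  qed
  have edge: "(x, i) \<in> edges (contour_graph S) \<longleftrightarrow> x \<in> sp_nodes S \<and> i \<le> length (sp_in S x)" for x i
    by (simp add: contour_graph_def)
  have map_node: "op_map p (corolla S x) = map (arr_map q) (contour_node S x) \<longleftrightarrow>
      (\<forall>i \<le> length (sp_in S x). arr_map q (gen_arrow (contour_graph S) (x, i)) = ae (x, i))"
    if "x \<in> sp_nodes S" for x and q :: "('c oriented, ('c, 'v) contour_arrow, 'o, 'a) cat_functor"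
    using len[OF that]
    by (auto simp: list_eq_iff_nth_eq contour_node_def ae_def less_Suc_eq_le simp del: upt_Suc)
  \<comment> \<open>Stated for arbitrary \<open>q\<close>, this yields both existence, with
    \<open>path_functor\<close>, and uniqueness, with \<open>q'\<close>.\<close>
  have iff: "p = operad_functor_comp (Free S) (Spliced_map (contour_cat S) q) (contour_proj S) \<longleftrightarrow>
      (\<forall>A \<in> verts (contour_graph S). obj_map q A = ov A) \<and>
      (\<forall>e \<in> edges (contour_graph S). arr_map q (gen_arrow (contour_graph S) e) = ae e)"
    if "cat_functor (contour_cat S) D q" for q
  proof -
    have "(\<forall>R \<in> sp_colors S. col_map p R = (obj_map q (Up R), obj_map q (Down R))) \<longleftrightarrow>
        (\<forall>A \<in> verts (contour_graph S). obj_map q A = ov A)"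
      by (auto simp: contour_graph_def ov_def prod_eq_iff)
    moreover have "(\<forall>x \<in> sp_nodes S. op_map p (corolla S x) = map (arr_map q) (contour_node S x)) \<longleftrightarrow>
        (\<forall>e \<in> edges (contour_graph S). arr_map q (gen_arrow (contour_graph S) e) = ae e)"
      by (auto simp: map_node edge)
    ultimately show ?thesis
      by (simp add: factorization_iff[OF p that])
  qed
  show ?thesis
  proof (rule ex1I)
    have q: "cat_functor (contour_cat S) D path_functor"
      unfolding contour_cat_def by (rule cat_functor_path_functor)
    then show "cat_functor (contour_cat S) D path_functor \<and>
        p = operad_functor_comp (Free S) (Spliced_map (contour_cat S) path_functor) (contour_proj S)"
      unfolding iff[OF q] by (simp add: path_functor_gen) (simp add: path_functor_def Free_cat_def)
    fix q' assume q': "cat_functor (contour_cat S) D q' \<and>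
      p = operad_functor_comp (Free S) (Spliced_map (contour_cat S) q') (contour_proj S)"
    show "q' = path_functor"
    proof (rule contour.cat_functor_Free_cat_eqI)
      show "cat_functor (Free_cat (contour_graph S)) D q'"
        using q' by (simp add: contour_cat_def)
      show "obj_map q' A = obj_map path_functor A" if "A \<in> verts (contour_graph S)" for A
        using q' iff[of q'] that by (simp add: path_functor_def Free_cat_def)
      show "arr_map q' (gen_arrow (contour_graph S) e) = arr_map path_functor (gen_arrow (contour_graph S) e)"
        if "e \<in> edges (contour_graph S)" for e
        using q' iff[of q'] that by (simp add: path_functor_gen)
    qed (rule cat_functor_path_functor)
  qed
qed

end

text \<open>Both languages range over the same constants: if p_S sends such a constant to
  \<open>[w]\<close>, then \<open>gr_proj G\<close> sends it to
  \<open>[arr_map q w]\<close>.\<close>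

lemma language_factorization:
  assumes "species (gr_species G)"
    and "gr_proj G = operad_functor_comp (Free (gr_species G))
      (Spliced_map (contour_cat (gr_species G)) q) (contour_proj (gr_species G))"
  shows "language G = arr_map q ` language (Univ (gr_species G) (gr_start G))"
proof -
  let ?S = "gr_species G"
  interpret species ?S by (rule assms)
  interpret pS: operad_functor "Free ?S" "Spliced (contour_cat ?S)" "contour_proj ?S"
    by (rule operad_functor_contour_proj)
  have "\<exists>w. op_map (contour_proj ?S) \<alpha> = [w] \<and> op_map (gr_proj G) \<alpha> = [arr_map q w]"
    if "\<alpha> \<in> constants (Free ?S) (gr_start G)" for \<alpha>
  proof -
    have \<alpha>: "\<alpha> \<in> Ops (Free ?S)" "op_ins (Free ?S) \<alpha> = []"
      using that by (auto simp: constants_def)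
    let ?ws = "op_map (contour_proj ?S) \<alpha>"
    have ws: "?ws \<in> Ops (Spliced (contour_cat ?S))" "gaps (contour_cat ?S) ?ws = []"
      using \<alpha> pS.op_map_in pS.inputs_map by auto
    \<comment> \<open>A spliced arrow without gaps is a single arrow;
      \<open>remdups_adj.cases\<close> splits lists into empty, singleton and longer ones.\<close>
    then obtain w where "?ws = [w]"
      by (cases ?ws rule: remdups_adj.cases) (auto simp: Spliced_def)
    with ws \<alpha> show ?thesis
      by (simp add: assms(2) operad_functor_comp_def compose_eq Spliced_map_def)
  qed
  then show ?thesis
    by (force simp: language_def Univ_def)
qed

text \<open>The language claim covers every factorizing \<open>q\<close>; by the first part there is
  exactly one, namely q_G.\<close>

theorem mainTheorem3:
  fixes S :: "('c, 'v) species" and s :: 'c and G :: "('o, 'a, 'c, 'v) grammar"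
  assumes "finite_species S" and "s \<in> sp_colors S"
    and "cf_grammar G" and "gr_species G = S" and "gr_start G = s"
  shows "(\<exists>!q. cat_functor (contour_cat S) (gr_cat G) q \<and>
            gr_proj G = operad_functor_comp (Free S) (Spliced_map (contour_cat S) q) (contour_proj S)) \<and>
         (\<forall>q. cat_functor (contour_cat S) (gr_cat G) q \<and>
            gr_proj G = operad_functor_comp (Free S) (Spliced_map (contour_cat S) q) (contour_proj S)
            \<longrightarrow> language G = arr_map q ` language (Univ S s))"
proof -
  interpret G: cf_grammar G by (rule assms)
  interpret finite_species S by (rule assms)
  show ?thesis
    using ex1_factorization[OF _ G.category] G.proj language_factorization[of G]
      species_axioms assms(4,5) by blast
qed

end
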